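(* Let $\mathcal E$ be a Banach lattice, let $M:\mathcal E\to\mathcal E$ be a positive compact linear operator, and let $h\in\mathcal E$ be a quasi-interior element of the positive cone $\mathcal E_+$. Then $\|M^nh\|^{1/n}\to r(M)$ as $n\to\infty$, where $r(M)$ is the spectral radius of $M$.
   Context: $M$ is positive if $M(\mathcal E_+)\subset\mathcal E_+$. An element $h\in\mathcal E_+$ is quasi-interior if $\langle h,f\rangle>0$ for every nonzero element $f$ of the positive cone of the dual space $\mathcal E^*$. The spectral radius $r(M)$ is $\sup\{|\lambda|:\lambda\in\sigma(M)\}$. *)

theory Defs
  imports "HOL-Analysis.Analysis"
begin

class banach_lattice = banach + ordered_real_vector + lattice +
  assumes lattice_norm: "sup x (- x) \<le> sup y (- y) \<Longrightarrow> norm x \<le> norm y"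

definition positive_cone :: "'a::banach_lattice set" where
  "positive_cone = {x. 0 \<le> x}"

definition positive_op :: "('a::banach_lattice \<Rightarrow> 'a) \<Rightarrow> bool" where
  "positive_op M \<longleftrightarrow> M ` positive_cone \<subseteq> positive_cone"

definition compact_op :: "('a::real_normed_vector \<Rightarrow> 'a) \<Rightarrow> bool" where
  "compact_op M \<longleftrightarrow> linear M \<and> compact (closure (M ` ball 0 1))"

definition dual_positive_cone :: "('a::banach_lattice \<Rightarrow> real) set" where
  "dual_positive_cone = {f. bounded_linear f \<and> (\<forall>x\<in>positive_cone. 0 \<le> f x)}"

definition quasi_interior :: "'a::banach_lattice \<Rightarrow> bool" where
  "quasi_interior h \<longleftrightarrow> h \<in> positive_cone \<and>
     (\<forall>f\<in>dual_positive_cone. f \<noteq> (\<lambda>x. 0) \<longrightarrow> 0 < f h)"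

text \<open>Spectrum of a real operator, defined through its complexification
  E_C = E \<times> E (pair (x,y) standing for x + i y), M_C(x,y) = (Mx, My).
  \<lambda> is in the spectrum iff M_C - \<lambda> I is not bijective (by the open mapping
  theorem, a bijective bounded operator on a Banach space has bounded inverse).\<close>
definition op_spectrum :: "('a::real_normed_vector \<Rightarrow> 'a) \<Rightarrow> complex set" where
  "op_spectrum M = {z. \<not> bij (\<lambda>(x, y).
      (M x - Re z *\<^sub>R x + Im z *\<^sub>R y, M y - Im z *\<^sub>R x - Re z *\<^sub>R y))}"

text \<open>Spectral radius sup {|\<lambda>| : \<lambda> \<in> \<sigma>(M)}; convention 0 for empty spectrum
  (only happens for the trivial space).\<close>
definition spectral_radius :: "('a::real_normed_vector \<Rightarrow> 'a) \<Rightarrow> real" where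
  "spectral_radius M = (if op_spectrum M = {} then 0 else Sup (cmod ` op_spectrum M))"

end

(* Let r be the infimum of all mu > 0 with |M^n| <= C mu^n. The Neumann series shows that the
   spectrum lies in the disc of radius r and that mu - M has a positive inverse for mu > r.
   Conversely a positive right inverse of mu - M with mu > 0 dominates M^n / mu^(n+1), so mu >= r.
   If r > 0 and r - M were bounded below, the positive inverses could be continued past r;
   hence, by compactness, r is an eigenvalue, and r is the spectral radius.

   For the lower bound, the range Y of r - M is a closed proper subspace (Riesz), and
   dist (M^n y) Y = r^n dist y Y. Since h is quasi-interior, some y with 0 <= y <= c h lies
   outside of Y, so c |M^n h| >= |M^n y| >= r^n dist y Y. *)
theory Submission
  imports Defs
begin

text \<open>The familiar lower bound pairs \<open>h\<close> with a positive eigenfunctional of the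
  adjoint, which presupposes the Krein-Rutman theorem for the dual operator. The quotient by
  \<open>Y\<close> takes the place of that functional: \<open>M\<close> acts on it as the scalar
  \<open>r\<close>, whatever the sign of the eigenvector. The price is that quasi-interiority,
  stated through positive functionals, does not directly place \<open>h\<close> outside of
  \<open>Y\<close>. A Hahn-Banach argument with a monotone sublinear functional converts it into
  approximation: every \<open>u \<ge> 0\<close> is a norm limit of truncations
  \<open>inf u (c *\<^sub>R h)\<close>, and a truncation close enough to a point outside of the
  closed set \<open>Y\<close> is outside as well. Positivity also replaces complex function theory.
  No other point of the circle |z| = r has to be examined: a positive right inverse at a single real
  point already bounds all powers of \<open>M\<close>, so continuation of the resolvent along the
  real axis suffices.\<close>

subsection \<open>Order and norm in Banach lattices\<close>

lemma lattice_norm_mono: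
  fixes x y :: "'a::banach_lattice"
  assumes "0 \<le> x" "x \<le> y"
  shows "norm x \<le> norm y"
proof (rule lattice_norm)
  have "- x \<le> x" "- y \<le> y"
    using assms by (auto intro: order_trans[of _ 0])
  then show "sup x (- x) \<le> sup y (- y)"
    using assms by (simp add: sup_absorb1)
qed

text \<open>Adding the bounds of \<open>x\<close> and \<open>- x\<close> by the modulus leaves
  \<open>0\<close> on one side and twice the modulus on the other.\<close>

lemma modulus_nonneg:
  fixes x :: "'a::banach_lattice"
  shows "0 \<le> sup x (- x)"
proof -
  have "x + - x \<le> sup x (- x) + sup x (- x)"
    by (intro add_mono) auto
  then have "0 \<le> 2 *\<^sub>R sup x (- x)"
    by (simp add: scaleR_2)
  then have "(1/2) *\<^sub>R 0 \<le> (1/2) *\<^sub>R (2 *\<^sub>R sup x (- x))"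
    by (intro scaleR_left_mono) auto
  then show ?thesis by simp
qed

lemma norm_modulus:
  fixes x :: "'a::banach_lattice"
  shows "norm (sup x (- x)) = norm x"
proof -
  have "- sup x (- x) \<le> sup x (- x)"
    using modulus_nonneg[of x] by (meson neg_le_0_iff_le order_trans)
  then have *: "sup (sup x (- x)) (- sup x (- x)) = sup x (- x)"
    by (simp add: sup_absorb1)
  show ?thesis
    by (intro antisym lattice_norm) (simp_all add: *)
qed

lemma norm_le_of_modulus_le:
  fixes x y :: "'a::banach_lattice"
  assumes "x \<le> y" "- x \<le> y"
  shows "norm x \<le> norm y"
proof -
  have "norm (sup x (- x)) \<le> norm y"
    using assms by (intro lattice_norm_mono modulus_nonneg) auto
  then show ?thesis by (simp add: norm_modulus)
qed

lemma norm_pos_part_le: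
  fixes x :: "'a::banach_lattice"
  shows "norm (sup x 0) \<le> norm x"
  using lattice_norm_mono[of "sup x 0" "sup x (- x)"] modulus_nonneg[of x]
  by (simp add: norm_modulus)

text \<open>A small norm of the excess \<open>sup (x - y) 0\<close> is to mean that \<open>x\<close>
  is close to an element below \<open>y\<close>; this identity names that element.\<close>

lemma pos_part_minus:
  fixes x y :: "'a::banach_lattice"
  shows "x - sup (x - y) 0 = inf x y"
proof (rule antisym)
  have "x - sup (x - y) 0 \<le> x - 0" "x - sup (x - y) 0 \<le> x - (x - y)"
    by (intro diff_left_mono; simp)+
  then show "x - sup (x - y) 0 \<le> inf x y" by simp
  have "x - y \<le> x - inf x y" "0 \<le> x - inf x y"
    by (auto intro: diff_left_mono)
  then have "sup (x - y) 0 \<le> x - inf x y" by simp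
  then show "inf x y \<le> x - sup (x - y) 0"
    by (simp add: le_diff_eq add.commute)
qed

text \<open>Serves to find a positive vector outside of a proper subspace: the two parts of a vector
  cannot both lie in the subspace unless the vector does.\<close>

lemma pos_part_diff:
  fixes x :: "'a::banach_lattice"
  shows "sup x 0 - sup (- x) 0 = x"
proof -
  have "sup x 0 = x + sup (- x) 0"
  proof (rule antisym)
    show "sup x 0 \<le> x + sup (- x) 0"
      using add_left_mono[of "- x" "sup (- x) 0" x] by simp
    have "- x \<le> sup x 0 - x" "0 \<le> sup x 0 - x"
      by (simp_all add: le_diff_eq)
    then have "sup (- x) 0 \<le> sup x 0 - x" by simp
    then have "x + sup (- x) 0 \<le> x + (sup x 0 - x)"
      by (rule add_left_mono)
    then show "x + sup (- x) 0 \<le> sup x 0" by simp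
  qed
  then show ?thesis by simp
qed

text \<open>Since \<open>- x \<le> X n - x\<close>, the positive part of \<open>- x\<close> is
  dominated by that of \<open>X n - x\<close>, whose norm tends to \<open>0\<close>.\<close>

lemma limit_nonneg:
  fixes X :: "nat \<Rightarrow> 'a::banach_lattice"
  assumes lim: "X \<longlonglongrightarrow> x" and pos: "\<And>n. 0 \<le> X n"
  shows "0 \<le> x"
proof -
  have "norm (sup (- x) 0) \<le> norm (X n - x)" for n
  proof -
    have "- x \<le> X n - x" using pos[of n] by simp
    then have "sup (- x) 0 \<le> sup (X n - x) 0" by (meson order_refl sup_mono)
    then have "norm (sup (- x) 0) \<le> norm (sup (X n - x) 0)"
      by (intro lattice_norm_mono) auto
    with norm_pos_part_le show ?thesis by (rule order_trans[rotated])
  qed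
  moreover have "(\<lambda>n. norm (X n - x)) \<longlonglongrightarrow> 0"
    using lim by (simp add: LIM_zero tendsto_norm_zero)
  ultimately have "norm (sup (- x) 0) \<le> 0"
    by (meson LIMSEQ_le_const)
  then have "sup (- x) 0 = 0" by simp
  then have "- x \<le> 0" by (metis sup_ge1)
  then show ?thesis by simp
qed

lemma pos_part_scaleR:
  fixes x :: "'a::banach_lattice"
  assumes "0 < t"
  shows "sup (t *\<^sub>R x) 0 = t *\<^sub>R sup x 0"
proof (rule antisym)
  show "sup (t *\<^sub>R x) 0 \<le> t *\<^sub>R sup x 0"
    using assms by (intro sup_least scaleR_left_mono scaleR_nonneg_nonneg) auto
  have "x \<le> sup (t *\<^sub>R x) 0 /\<^sub>R t" "0 \<le> sup (t *\<^sub>R x) 0 /\<^sub>R t"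
    using assms by (simp_all add: pos_le_divideR_eq)
  then have "sup x 0 \<le> sup (t *\<^sub>R x) 0 /\<^sub>R t" by simp
  then show "t *\<^sub>R sup x 0 \<le> sup (t *\<^sub>R x) 0"
    by (simp only: pos_le_divideR_eq[OF assms])
qed

text \<open>With \<open>pos_part_scaleR\<close> this makes \<open>norm (sup x 0)\<close> sublinear
  in \<open>x\<close>. Linear functionals below it are positive, since it vanishes on the negatives
  of positive vectors.\<close>

lemma norm_pos_part_add_le:
  fixes x y :: "'a::banach_lattice"
  shows "norm (sup (x + y) 0) \<le> norm (sup x 0) + norm (sup y 0)"
proof -
  have "sup (x + y) 0 \<le> sup x 0 + sup y 0"
    by (intro sup_least add_mono add_nonneg_nonneg) auto
  then have "norm (sup (x + y) 0) \<le> norm (sup x 0 + sup y 0)"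
    by (intro lattice_norm_mono) auto
  with norm_triangle_ineq show ?thesis by (rule order_trans[rotated])
qed

subsection \<open>Sublinear functionals\<close>

definition sublinear :: "('a::real_vector \<Rightarrow> real) \<Rightarrow> bool" where
  "sublinear p \<longleftrightarrow> (\<forall>x y. p (x + y) \<le> p x + p y) \<and> (\<forall>t x. 0 \<le> t \<longrightarrow> p (t *\<^sub>R x) = t * p x)"

lemma sublinear_add: "sublinear p \<Longrightarrow> p (x + y) \<le> p x + p y"
  and sublinear_scale: "sublinear p \<Longrightarrow> 0 \<le> t \<Longrightarrow> p (t *\<^sub>R x) = t * p x"
  by (auto simp: sublinear_def)

lemma sublinear_zero: "sublinear p \<Longrightarrow> p 0 = 0"
  using sublinear_scale[of p 0 0] by simp

lemma sublinear_neg_le: "sublinear p \<Longrightarrow> - p (- x) \<le> p x"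
  using sublinear_add[of p x "- x"] sublinear_zero[of p] by simp

text \<open>The index may change under addition and scaling, so a single \<open>F i\<close> need not
  be sublinear. This form covers shifts along a ray, chains in Zorn's lemma and truncation at
  multiples of \<open>h\<close>. The minorant \<open>m\<close> makes each infimum a genuine lower
  bound.\<close>

lemma sublinear_INF:
  fixes F :: "'i \<Rightarrow> 'a::real_vector \<Rightarrow> real"
  assumes ne: "I \<noteq> {}" and low: "\<And>i x. i \<in> I \<Longrightarrow> m x \<le> F i x"
    and add: "\<And>i j x y. i \<in> I \<Longrightarrow> j \<in> I \<Longrightarrow> \<exists>k\<in>I. F k (x + y) \<le> F i x + F j y"
    and scale: "\<And>t i x. 0 < t \<Longrightarrow> i \<in> I \<Longrightarrow> \<exists>j\<in>I. F j (t *\<^sub>R x) \<le> t * F i x"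
    and zero: "\<And>i. i \<in> I \<Longrightarrow> F i 0 = 0"
  shows "sublinear (\<lambda>x. INF i\<in>I. F i x)"
proof -
  define q where "q x = (INF i\<in>I. F i x)" for x
  have q_le: "q x \<le> F i x" if "i \<in> I" for i x
    unfolding q_def using that low by (intro cINF_lower bdd_belowI2[where m = "m x"]) auto
  have q_ge: "b \<le> q x" if "\<And>i. i \<in> I \<Longrightarrow> b \<le> F i x" for b x
    unfolding q_def using ne that by (intro cINF_greatest) auto
  have "q (x + y) \<le> q x + q y" for x y
  proof -
    have *: "q (x + y) \<le> F i x + F j y" if "i \<in> I" "j \<in> I" for i j
      using add[OF that, of x y] q_le order_trans by blast
    have "q (x + y) - F j y \<le> q x" if "j \<in> I" for j
    proof (rule q_ge)
      fix i assume "i \<in> I"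
      show "q (x + y) - F j y \<le> F i x"
        using *[OF \<open>i \<in> I\<close> that] by linarith
    qed
    then have "q (x + y) - q x \<le> F j y" if "j \<in> I" for j
      using that by fastforce
    then have "q (x + y) - q x \<le> q y" by (rule q_ge)
    then show ?thesis by simp
  qed
  moreover have scale_le: "q (t *\<^sub>R x) \<le> t * q x" if "0 < t" for t x
  proof -
    have "q (t *\<^sub>R x) / t \<le> q x"
    proof (rule q_ge)
      fix i assume "i \<in> I"
      then have "q (t *\<^sub>R x) \<le> t * F i x"
        using scale[OF that \<open>i \<in> I\<close>, of x] q_le order_trans by blast
      then show "q (t *\<^sub>R x) / t \<le> F i x"
        using that by (simp add: field_simps)
    qed
    then show ?thesis using that by (simp add: field_simps)
  qed
  moreover have "q (t *\<^sub>R x) = t * q x" if "0 \<le> t" for t x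
  proof (cases "t = 0")
    case True
    have "q 0 = 0"
      unfolding q_def using ne zero by (simp add: image_constant_conv cong: INF_cong_simp)
    with True show ?thesis by simp
  next
    case False
    then have t: "t > 0" using that by simp
    \<comment> \<open>Scaling was assumed in one direction only; the factor \<open>1 / t\<close>
      applied to \<open>t *\<^sub>R x\<close> yields the other.\<close>
    have "q ((1/t) *\<^sub>R (t *\<^sub>R x)) \<le> (1/t) * q (t *\<^sub>R x)"
      using t by (intro scale_le) auto
    then have "t * q x \<le> q (t *\<^sub>R x)"
      using t by (simp add: field_simps)
    with scale_le[OF t] show ?thesis by (meson antisym)
  qed
  ultimately show ?thesis by (simp add: sublinear_def q_def)
qed

text \<open>The witness is the infimum of \<open>p (x + t *\<^sub>R v) - t * p v\<close> over
  \<open>t \<ge> 0\<close>; its terms at \<open>t = 0\<close> and \<open>t = 1\<close> are the two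
  upper bounds. If \<open>p\<close> is minimal, the witness is \<open>p\<close> itself and the
  second bound makes \<open>p\<close> additive in the direction \<open>v\<close>.\<close>

lemma sublinear_lower:
  fixes p :: "'a::real_vector \<Rightarrow> real"
  assumes p: "sublinear p"
  obtains q where "sublinear q" "\<And>x. q x \<le> p x" "\<And>x. q x \<le> p (x + v) - p v"
proof -
  define F where "F t x = p (x + t *\<^sub>R v) - t * p v" for t x
  have low: "- p (- x) \<le> F t x" if "t \<in> {0..}" for x t
    using sublinear_add[OF p, of "x + t *\<^sub>R v" "- x"] sublinear_scale[OF p, of t v] that
    by (simp add: F_def)
  have q_le: "(INF t\<in>{0..}. F t x) \<le> F t x" if "0 \<le> t" for x t
    using that low by (intro cINF_lower bdd_belowI2[where m = "- p (- x)"]) auto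
  show thesis
  proof (rule that)
    show "sublinear (\<lambda>x. INF t\<in>{0..}. F t x)"
    proof (rule sublinear_INF[where m = "\<lambda>x. - p (- x)"])
      fix s t :: real and x y :: 'a
      assume st: "s \<in> {0..}" "t \<in> {0..}"
      have "F (s + t) (x + y) \<le> F s x + F t y"
        using sublinear_add[OF p, of "x + s *\<^sub>R v" "y + t *\<^sub>R v"]
        by (simp add: F_def algebra_simps)
      with st show "\<exists>k\<in>{0..}. F k (x + y) \<le> F s x + F t y"
        by (intro bexI[of _ "s + t"]) auto
    next
      fix c t :: real and x :: 'a
      assume ct: "0 < c" "t \<in> {0..}"
      have "F (c * t) (c *\<^sub>R x) = p (c *\<^sub>R (x + t *\<^sub>R v)) - c * t * p v"
        by (simp add: F_def scaleR_add_right)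
      also have "\<dots> = c * F t x"
        using ct(1) by (subst sublinear_scale[OF p]) (simp_all add: F_def algebra_simps)
      finally show "\<exists>j\<in>{0..}. F j (c *\<^sub>R x) \<le> c * F t x"
        using ct by (intro bexI[of _ "c * t"]) auto
    qed (use low in \<open>auto simp: F_def sublinear_scale[OF p]\<close>)
    show "(INF t\<in>{0..}. F t x) \<le> p x" for x
      using q_le[of 0 x] by (simp add: F_def)
    show "(INF t\<in>{0..}. F t x) \<le> p (x + v) - p v" for x
      using q_le[of 1 x] by (simp add: F_def)
  qed
qed

text \<open>Zorn's lemma for the reversed pointwise order. Every sublinear \<open>q \<le> p\<close>
  is bounded below by \<open>- p (- x)\<close>, so chains have finite infima; these are subadditive
  because the smaller of two members serves both summands.\<close>

lemma minimal_sublinear_exists: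
  fixes p :: "'a::real_vector \<Rightarrow> real"
  assumes p: "sublinear p"
  obtains q where "sublinear q" "q \<le> p" "\<And>q'. sublinear q' \<Longrightarrow> q' \<le> q \<Longrightarrow> q' = q"
proof -
  define A where "A = {q. sublinear q \<and> q \<le> p}"
  have "\<exists>m\<in>A. \<forall>a\<in>A. a \<le> m \<longrightarrow> a = m"
  proof (rule predicate_Zorn)
    show "partial_order_on A (relation_of (\<lambda>q q'. q' \<le> q) A)"
      by (auto simp: partial_order_on_def preorder_on_def refl_on_def trans_def antisym_def
          relation_of_def)
    fix C assume "C \<in> Chains (relation_of (\<lambda>q q'. q' \<le> q) A)"
    then have CA: "C \<subseteq> A" and chain: "\<And>q q'. q \<in> C \<Longrightarrow> q' \<in> C \<Longrightarrow> q \<le> q' \<or> q' \<le> q"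
      by (auto simp: Chains_def relation_of_def)
    show "\<exists>u\<in>A. \<forall>a\<in>C. u \<le> a"
    proof (cases "C = {}")
      case True
      then show ?thesis using p by (auto simp: A_def)
    next
      case False
      define u where "u x = (INF q\<in>C. q x)" for x
      have sub: "sublinear q" "q x \<le> p x" if "q \<in> C" for q x
        using that CA by (auto simp: A_def le_fun_def)
      have low: "- p (- x) \<le> q x" if "q \<in> C" for q x
        using sublinear_neg_le[OF sub(1)[OF that], of x] sub(2)[OF that, of "- x"] by linarith
      have u_le: "u x \<le> q x" if "q \<in> C" for q x
        unfolding u_def using that low
        by (intro cINF_lower bdd_belowI2[where m = "- p (- x)"]) auto
      have "sublinear u"
        unfolding u_def
      proof (rule sublinear_INF[OF False low])
        fix q q' x y assume qq: "q \<in> C" "q' \<in> C"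
        then obtain r where r: "r \<in> C" "r \<le> q" "r \<le> q'"
          using chain[OF qq] by (metis order_refl)
        have "r (x + y) \<le> r x + r y" using sub(1)[OF r(1)] by (rule sublinear_add)
        also have "\<dots> \<le> q x + q' y" using r by (intro add_mono) (auto simp: le_fun_def)
        finally show "\<exists>k\<in>C. k (x + y) \<le> q x + q' y" using r(1) by blast
      next
        fix t :: real and q x assume "0 < t" "q \<in> C"
        then show "\<exists>j\<in>C. j (t *\<^sub>R x) \<le> t * q x"
          by (intro bexI[of _ q]) (simp_all add: sublinear_scale[OF sub(1)])
      qed (simp_all add: sublinear_zero[OF sub(1)])
      moreover have "u \<le> p"
        using False u_le sub(2) unfolding le_fun_def by (metis all_not_in_conv order_trans)
      ultimately have "u \<in> A" by (simp add: A_def)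
      then show ?thesis using u_le by (auto simp: le_fun_def)
    qed
  qed
  then obtain m where "m \<in> A" "\<And>a. a \<in> A \<Longrightarrow> a \<le> m \<Longrightarrow> a = m" by blast
  then show thesis
    by (intro that[of m]) (auto simp: A_def intro: order_trans)
qed

text \<open>A minimal sublinear functional is linear, as lowering it in any direction changes
  nothing. Lowering \<open>p\<close> once in the direction \<open>v\<close> before minimising gives
  \<open>f (- v) \<le> - p v\<close>, which forces equality at \<open>v\<close>.\<close>

lemma hahn_banach_sublinear:
  fixes p :: "'a::real_vector \<Rightarrow> real"
  assumes p: "sublinear p"
  obtains f where "linear f" "\<And>x. f x \<le> p x" "f v = p v"
proof -
  obtain p' where p': "sublinear p'" "\<And>x. p' x \<le> p x" "\<And>x. p' x \<le> p (x + v) - p v"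
    using sublinear_lower[OF p] by blast
  obtain f where f: "sublinear f" "f \<le> p'"
    and min: "\<And>q'. sublinear q' \<Longrightarrow> q' \<le> f \<Longrightarrow> q' = f"
    using minimal_sublinear_exists[OF p'(1)] by metis
  have add: "f (x + y) = f x + f y" for x y
  proof -
    obtain q where q: "sublinear q" "\<And>z. q z \<le> f z" "\<And>z. q z \<le> f (z + y) - f y"
      using sublinear_lower[OF f(1)] by blast
    then have "q = f" by (intro min) (auto simp: le_fun_def)
    then show ?thesis using q(3)[of x] sublinear_add[OF f(1), of x y] by force
  qed
  have minus: "f (- x) = - f x" for x
    using add[of x "- x"] sublinear_zero[OF f(1)] by simp
  have "f (c *\<^sub>R x) = c * f x" for c x
    using sublinear_scale[OF f(1), of c x] sublinear_scale[OF f(1), of "- c" x]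
    by (cases "0 \<le> c") (auto simp: minus)
  then have lin: "linear f" by (intro linearI) (auto simp: add)
  have le: "f x \<le> p x" for x using f(2) p'(2) by (meson le_fun_def order_trans)
  have "f (- v) \<le> p' (- v)" using f(2) by (auto simp: le_fun_def)
  then have "f (- v) \<le> - p v"
    using p'(3)[of "- v"] sublinear_zero[OF p] by simp
  then have "f v = p v" using minus le[of v] by simp
  with lin le show thesis by (intro that)
qed

section \<open>Truncation at multiples of a quasi-interior element\<close>

text \<open>The sublinear functional \<open>x \<mapsto> inf\<^sub>c \<parallel>(x - c h)\<^sup>+\<parallel>\<close> is monotone and nonpositive at \<open>h\<close>,
  so every linear functional below it is positive and vanishes at \<open>h\<close>.\<close>

lemma quasi_interior_truncation:
  fixes h v :: "'a::banach_lattice"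
  assumes h: "quasi_interior h" and "\<epsilon> > 0"
  obtains c where "0 \<le> c" "norm (sup (v - c *\<^sub>R h) 0) < \<epsilon>"
proof -
  have h0: "0 \<le> h" using h by (simp add: quasi_interior_def positive_cone_def)
  define F where "F c x = norm (sup (x - c *\<^sub>R h) 0)" for c x
  define p where "p x = (INF c\<in>{0..}. F c x)" for x
  have bdd: "bdd_below ((\<lambda>c. F c x) ` {0..})" for x
    by (intro bdd_belowI2[where m = 0]) (simp add: F_def)
  have p_le: "p x \<le> F c x" if "0 \<le> c" for c x
    unfolding p_def using that bdd by (intro cINF_lower) auto
  have "sublinear p"
    unfolding p_def
  proof (rule sublinear_INF[where m = "\<lambda>x. 0"])
    fix c d :: real and x y :: 'a assume cd: "c \<in> {0..}" "d \<in> {0..}"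
    have "F (c + d) (x + y) \<le> F c x + F d y"
      using norm_pos_part_add_le[of "x - c *\<^sub>R h" "y - d *\<^sub>R h"]
      by (simp add: F_def algebra_simps)
    with cd show "\<exists>k\<in>{0..}. F k (x + y) \<le> F c x + F d y"
      by (intro bexI[of _ "c + d"]) auto
  next
    fix t c :: real and x :: 'a assume tc: "0 < t" "c \<in> {0..}"
    have "F (t * c) (t *\<^sub>R x) = t * F c x"
      using pos_part_scaleR[OF tc(1), of "x - c *\<^sub>R h"] tc(1)
      by (simp add: F_def scaleR_diff_right)
    with tc show "\<exists>j\<in>{0..}. F j (t *\<^sub>R x) \<le> t * F c x"
      by (intro bexI[of _ "t * c"]) auto
  next
    fix c :: real assume "c \<in> {0..}"
    then have "0 \<le> c *\<^sub>R h" using h0 by (simp add: scaleR_nonneg_nonneg)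
    then show "F c 0 = 0" by (simp add: F_def sup_absorb2)
  qed (auto simp: F_def)
  then obtain f where f: "linear f" "\<And>x. f x \<le> p x" "f v = p v"
    using hahn_banach_sublinear by blast
  have f_le: "f x \<le> norm (sup x 0)" for x
    using f(2)[of x] p_le[of 0 x] by (simp add: F_def)
  have f_minus: "f (- x) = - f x" for x using f(1) by (rule linear_neg)
  have "norm (f x) \<le> norm x * 1" for x
    using f_le[of x] f_le[of "- x"] norm_pos_part_le[of x] norm_pos_part_le[of "- x"] f_minus[of x]
    by simp
  then have "bounded_linear f"
    using f(1) by (intro bounded_linear_intro[where K = 1]) (simp_all add: linear_add linear_scale)
  moreover have "0 \<le> f x" if "0 \<le> x" for x
    using f_le[of "- x"] f_minus[of x] that by (simp add: sup_absorb2)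
  ultimately have dual: "f \<in> dual_positive_cone"
    by (simp add: dual_positive_cone_def positive_cone_def)
  \<comment> \<open>The index \<open>c = 1\<close> contributes the positive part of
    \<open>h - h\<close>, which is \<open>0\<close>. A nonzero \<open>f\<close> would be strictly
    positive at \<open>h\<close>; hence \<open>f\<close> vanishes, and \<open>f v = p v\<close>
    makes the infimum at \<open>v\<close> zero.\<close>
  have "f h \<le> 0"
    using f(2)[of h] p_le[of 1 h] by (simp add: F_def)
  then have "f = (\<lambda>x. 0)"
    using h dual unfolding quasi_interior_def by force
  then have "p v < \<epsilon>" using f(3) \<open>\<epsilon> > 0\<close> by simp
  then obtain c where "c \<in> {0..}" "F c v < \<epsilon>"
    unfolding p_def using bdd[of v] by (subst (asm) cINF_less_iff) auto
  then show thesis by (intro that[of c]) (auto simp: F_def)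
qed

subsection \<open>Compact perturbations of multiples of the identity\<close>

lemma compact_op_linear: "compact_op K \<Longrightarrow> linear K"
  by (simp add: compact_op_def)

lemma compact_op_bounded_linear:
  assumes "compact_op K"
  shows "bounded_linear K"
proof -
  have lin: "linear K" using assms by (rule compact_op_linear)
  have "bounded (K ` ball 0 1)"
    using assms bounded_subset[OF compact_imp_bounded closure_subset]
    by (auto simp: compact_op_def)
  then obtain B where "\<forall>y\<in>K ` ball 0 1. norm y \<le> B"
    by (auto simp only: bounded_iff)
  then have B: "norm (K x) \<le> B" if "norm x < 1" for x
    using that by simp
  have "norm (K x) \<le> norm x * (2 * B)" for x
  proof (cases "x = 0")
    case True
    then show ?thesis using lin by (simp add: linear_0)
  next
    case False
    \<comment> \<open>The unit ball is open, so \<open>x\<close> is scaled to norm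
      \<open>1 / 2\<close>; this doubles the constant.\<close>
    have "norm (K ((1 / (2 * norm x)) *\<^sub>R x)) \<le> B"
      using False by (intro B) simp
    then show ?thesis
      using False by (simp add: linear_scale[OF lin] field_simps)
  qed
  with lin show ?thesis
    by (intro bounded_linear.intro) (auto simp: bounded_linear_axioms_def)
qed

lemma compact_op_convergent_subseq:
  fixes x :: "nat \<Rightarrow> 'a::real_normed_vector"
  assumes K: "compact_op K" and x: "\<And>n. norm (x n) \<le> B"
  obtains l r where "strict_mono (r :: nat \<Rightarrow> nat)" "(\<lambda>n. K (x (r n))) \<longlonglongrightarrow> l"
proof -
  have lin: "linear K" using K by (rule compact_op_linear)
  \<comment> \<open>Strictly above \<open>B\<close>, so that division by \<open>D\<close> lands in
    the open ball.\<close>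
  define D where "D = B + 1"
  have "B \<ge> 0" using order_trans[OF norm_ge_zero x[of 0]] .
  then have D: "D > 0" "norm (x n) < D" for n
    using x[of n] by (simp_all add: D_def)
  define y where "y n = (1 / D) *\<^sub>R x n" for n
  have "K (y n) \<in> closure (K ` ball 0 1)" for n
  proof -
    have "y n \<in> ball 0 1" using D(1) D(2)[of n] by (simp add: y_def)
    then show ?thesis by (intro subsetD[OF closure_subset] imageI)
  qed
  moreover have "seq_compact (closure (K ` ball 0 1))"
    using K by (simp add: compact_op_def compact_eq_seq_compact_metric)
  ultimately obtain l r where r: "strict_mono (r :: nat \<Rightarrow> nat)" "((\<lambda>n. K (y n)) \<circ> r) \<longlonglongrightarrow> l"
    using seq_compactE[of "closure (K ` ball 0 1)" "\<lambda>n. K (y n)"] by metis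
  have "(\<lambda>n. D *\<^sub>R K (y (r n))) \<longlonglongrightarrow> D *\<^sub>R l"
    using r(2) by (intro tendsto_intros) (simp add: o_def)
  then have "(\<lambda>n. K (x (r n))) \<longlonglongrightarrow> D *\<^sub>R l"
    using D(1) by (simp add: y_def linear_scale[OF lin])
  with r(1) show thesis by (rule that)
qed

text \<open>The sign is opposite to that in \<open>op_spectrum\<close>, so that the inverse is
  positive when \<open>K\<close> is positive and bounded and \<open>r\<close> is large.\<close>

definition shift_op :: "real \<Rightarrow> ('a::real_normed_vector \<Rightarrow> 'a) \<Rightarrow> 'a \<Rightarrow> 'a" where
  "shift_op r K x = r *\<^sub>R x - K x"

lemma bounded_linear_shift_op: "bounded_linear K \<Longrightarrow> bounded_linear (shift_op r K)"
  unfolding shift_op_def by (intro bounded_linear_sub bounded_linear_scaleR_right)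

text \<open>Along a subsequence \<open>K (x n)\<close> converges, and then so does
  \<open>x n\<close>, which is the sum of \<open>shift_op c K (x n)\<close> and
  \<open>K (x n)\<close> divided by \<open>c\<close>.\<close>

lemma compact_shift_convergent_subseq:
  fixes x :: "nat \<Rightarrow> 'a::real_normed_vector"
  assumes K: "compact_op K" and c: "c \<noteq> 0" and x: "\<And>n. norm (x n) \<le> B"
    and z: "(\<lambda>n. shift_op c K (x n)) \<longlonglongrightarrow> z"
  obtains l r where "strict_mono (r :: nat \<Rightarrow> nat)" "(\<lambda>n. x (r n)) \<longlonglongrightarrow> l" "shift_op c K l = z"
proof -
  obtain k r where r: "strict_mono (r :: nat \<Rightarrow> nat)" and k: "(\<lambda>n. K (x (r n))) \<longlonglongrightarrow> k"
    using compact_op_convergent_subseq[OF K x] .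
  have zr: "(\<lambda>n. shift_op c K (x (r n))) \<longlonglongrightarrow> z"
    using LIMSEQ_subseq_LIMSEQ[OF z r] by (simp add: o_def)
  define l where "l = (1 / c) *\<^sub>R (z + k)"
  have "(\<lambda>n. (1 / c) *\<^sub>R (shift_op c K (x (r n)) + K (x (r n)))) \<longlonglongrightarrow> l"
    unfolding l_def by (intro tendsto_intros zr k)
  then have l: "(\<lambda>n. x (r n)) \<longlonglongrightarrow> l"
    using c by (simp add: shift_op_def)
  have "(\<lambda>n. shift_op c K (x (r n))) \<longlonglongrightarrow> shift_op c K l"
    using bounded_linear_shift_op[OF compact_op_bounded_linear[OF K]] l
    by (rule bounded_linear.tendsto)
  then have "shift_op c K l = z" using zr by (rule LIMSEQ_unique)
  then show thesis by (intro that[OF r l])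
qed

text \<open>Otherwise there are unit vectors with images tending to \<open>0\<close>; a limit point
  of them is a unit vector in the kernel.\<close>

lemma compact_shift_bounded_below:
  fixes K :: "'a::real_normed_vector \<Rightarrow> 'a"
  assumes K: "compact_op K" and c: "c \<noteq> 0"
    and inj: "\<And>x. shift_op c K x = 0 \<Longrightarrow> x = 0"
  obtains b where "b > 0" "\<And>x. b * norm x \<le> norm (shift_op c K x)"
proof (rule ccontr)
  assume neg: "\<not> thesis"
  have lin: "linear (shift_op c K)"
    using bounded_linear_shift_op[OF compact_op_bounded_linear[OF K]] bounded_linear.linear by blast
  have "\<exists>x. norm x = 1 \<and> norm (shift_op c K x) \<le> inverse (real (Suc n))" for n
  proof -
    have "\<exists>x. norm (shift_op c K x) < inverse (real (Suc n)) * norm x"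
    proof (rule ccontr)
      assume "\<not> ?thesis"
      then show False
        using that[of "inverse (real (Suc n))"] neg by (simp add: not_less)
    qed
    then obtain x where x: "norm (shift_op c K x) < inverse (real (Suc n)) * norm x" ..
    then have "x \<noteq> 0" by auto
    then show ?thesis using x
      by (intro exI[of _ "(1 / norm x) *\<^sub>R x"]) (simp add: linear_scale[OF lin] field_simps)
  qed
  then obtain u where u: "\<And>n. norm (u n) = 1"
    and Tu: "\<And>n. norm (shift_op c K (u n)) \<le> inverse (real (Suc n))"
    by metis
  have "(\<lambda>n. shift_op c K (u n)) \<longlonglongrightarrow> 0"
    using Tu by (intro Lim_null_comparison[OF _ LIMSEQ_inverse_real_of_nat]) auto
  then obtain l r where l: "(\<lambda>n. u (r n)) \<longlonglongrightarrow> l" "shift_op c K l = 0"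
    using compact_shift_convergent_subseq[OF K c, of u 1] u by (metis order_refl)
  have "(\<lambda>n. norm (u (r n))) \<longlonglongrightarrow> norm l" using l(1) by (rule tendsto_norm)
  then have "norm l = 1" using u by (simp add: LIMSEQ_const_iff)
  then show False using inj[OF l(2)] by simp
qed

text \<open>Substitute for a nearest point, which need not exist. Any factor above 1 would do; the
  \<open>2\<close> becomes the distance \<open>1 / 2\<close> in the Riesz arguments.\<close>

lemma almost_best_approximation:
  fixes N :: "'a::real_normed_vector set"
  assumes "closed N" "N \<noteq> {}"
  obtains y where "y \<in> N" "\<And>z. z \<in> N \<Longrightarrow> norm (x - y) \<le> 2 * norm (x - z)"
proof (cases "x \<in> N")
  case True
  then show thesis by (intro that[of x]) auto
next
  case False
  then have d: "infdist x N > 0"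
    using assms in_closed_iff_infdist_zero[of N x] infdist_nonneg[of x N] by fastforce
  have "\<exists>y\<in>N. dist x y < 2 * infdist x N"
  proof (rule ccontr)
    assume "\<not> ?thesis"
    then have "2 * infdist x N \<le> infdist x N"
      using assms(2) by (subst (2) infdist_notempty) (auto intro!: cINF_greatest simp: not_less)
    then show False using d by simp
  qed
  then obtain y where "y \<in> N" "dist x y < 2 * infdist x N" by blast
  moreover have "infdist x N \<le> norm (x - z)" if "z \<in> N" for z
    using infdist_le[OF that, of x] by (simp add: dist_norm)
  ultimately show thesis by (intro that[of y]) (force simp: dist_norm)+
qed

text \<open>A bounded inverse modulo the kernel \<open>N\<close>. If it failed, preimages corrected
  by nearly best elements of \<open>N\<close> would give unit vectors at distance at least
  \<open>1 / 2\<close> from \<open>N\<close> with images tending to \<open>0\<close>, but their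
  limit points lie in \<open>N\<close>.\<close>

lemma compact_shift_bounded_preimage:
  fixes K :: "'a::real_normed_vector \<Rightarrow> 'a"
  assumes K: "compact_op K" and c: "c \<noteq> 0"
  obtains B where "\<And>x. \<exists>w. shift_op c K w = shift_op c K x \<and> norm w \<le> B * norm (shift_op c K x)"
proof (rule ccontr)
  assume neg: "\<not> thesis"
  let ?T = "shift_op c K"
  have bl: "bounded_linear ?T"
    by (rule bounded_linear_shift_op[OF compact_op_bounded_linear[OF K]])
  then have lin: "linear ?T" by (rule bounded_linear.linear)
  define N where "N = {x. ?T x = 0}"
  have "closed N"
    unfolding N_def using bl by (intro closed_Collect_eq) (auto intro: linear_continuous_on)
  moreover have "N \<noteq> {}" using linear_0[OF lin] by (auto simp: N_def)
  ultimately have best: "\<exists>y\<in>N. \<forall>z\<in>N. norm (x - y) \<le> 2 * norm (x - z)" for x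
    using almost_best_approximation[of N x] by metis
  have "\<exists>u. norm u = 1 \<and> norm (?T u) \<le> inverse (real (Suc n)) \<and> (\<forall>v\<in>N. 1 / 2 \<le> norm (u - v))" for n
  proof -
    have "\<exists>x. \<forall>w. ?T w = ?T x \<longrightarrow> real (Suc n) * norm (?T x) < norm w"
    proof (rule ccontr)
      assume "\<not> ?thesis"
      then show False
        using that[of "real (Suc n)"] neg by (simp add: not_less)
    qed
    then obtain x where x: "\<And>w. ?T w = ?T x \<Longrightarrow> real (Suc n) * norm (?T x) < norm w"
      by blast
    obtain y where y: "y \<in> N" "\<And>z. z \<in> N \<Longrightarrow> norm (x - y) \<le> 2 * norm (x - z)"
      using best by blast
    define w where "w = x - y"
    have Tw: "?T w = ?T x"
      using y(1) by (simp add: w_def N_def linear_diff[OF lin])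
    have w: "real (Suc n) * norm (?T w) < norm w" using x Tw by simp
    then have pos: "norm w > 0" by (rule le_less_trans[rotated]) simp
    show ?thesis
    proof (intro exI conjI ballI)
      show "norm ((1 / norm w) *\<^sub>R w) = 1" using pos by simp
      show "norm (?T ((1 / norm w) *\<^sub>R w)) \<le> inverse (real (Suc n))"
        using w pos by (simp add: linear_scale[OF lin] field_simps)
      fix v assume "v \<in> N"
      \<comment> \<open>The competitor \<open>y + norm w *\<^sub>R v\<close> lies in
        \<open>N\<close>; comparing \<open>y\<close> with it and dividing by \<open>norm w\<close>
        gives the distance from \<open>v\<close>.\<close>
      then have "norm w \<le> 2 * norm (x - (y + norm w *\<^sub>R v))"
        unfolding w_def using y(1)
        by (intro y(2)) (simp add: N_def linear_add[OF lin] linear_scale[OF lin])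
      also have "x - (y + norm w *\<^sub>R v) = norm w *\<^sub>R ((1 / norm w) *\<^sub>R w - v)"
        using pos by (simp add: w_def algebra_simps)
      finally show "1 / 2 \<le> norm ((1 / norm w) *\<^sub>R w - v)"
        using pos by simp
    qed
  qed
  then obtain u where u: "\<And>n. norm (u n) = 1"
    and Tu: "\<And>n. norm (?T (u n)) \<le> inverse (real (Suc n))"
    and far: "\<And>n v. v \<in> N \<Longrightarrow> 1 / 2 \<le> norm (u n - v)"
    by metis
  have "(\<lambda>n. ?T (u n)) \<longlonglongrightarrow> 0"
    using Tu by (intro Lim_null_comparison[OF _ LIMSEQ_inverse_real_of_nat]) auto
  then obtain l r where l: "(\<lambda>n. u (r n)) \<longlonglongrightarrow> l" "?T l = 0"
    using compact_shift_convergent_subseq[OF K c, of u 1] u by (metis order_refl)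
  have "(\<lambda>n. norm (u (r n) - l)) \<longlonglongrightarrow> 0"
    using l(1) by (simp add: LIM_zero tendsto_norm_zero)
  then have "(1/2 :: real) \<le> 0"
    using far[of l] l(2) by (intro LIMSEQ_le_const) (auto simp: N_def)
  then show False by simp
qed

text \<open>Preimages of a convergent sequence can be chosen bounded, and a limit point of them is
  mapped to the limit.\<close>

lemma compact_shift_closed_range:
  fixes K :: "'a::real_normed_vector \<Rightarrow> 'a"
  assumes K: "compact_op K" and c: "c \<noteq> 0"
  shows "closed (range (shift_op c K))"
  unfolding closed_sequential_limits
proof (intro allI impI, elim conjE)
  let ?T = "shift_op c K"
  fix z l assume "\<forall>n. z n \<in> range ?T" and z: "z \<longlonglongrightarrow> l"
  obtain B where B: "\<And>x. \<exists>w. ?T w = ?T x \<and> norm w \<le> B * norm (?T x)"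
    using compact_shift_bounded_preimage[OF K c] by blast
  have "\<exists>w. ?T w = z n \<and> norm w \<le> B * norm (z n)" for n
    using \<open>\<forall>n. z n \<in> range ?T\<close> B by (metis rangeE)
  then obtain w where w: "\<And>n. ?T (w n) = z n" "\<And>n. norm (w n) \<le> B * norm (z n)"
    by metis
  obtain D where zD: "\<And>n. norm (z n) \<le> D"
    using convergent_imp_bounded[OF z] by (auto simp: bounded_iff)
  have D: "norm (w n) \<le> \<bar>B\<bar> * D" for n
  proof -
    have "B * norm (z n) \<le> \<bar>B\<bar> * D"
      by (intro mult_mono zD) auto
    with w(2) show ?thesis by (rule order_trans)
  qed
  have "(\<lambda>n. ?T (w n)) \<longlonglongrightarrow> l" using z w(1) by simp
  then obtain w' where "?T w' = l"
    by (rule compact_shift_convergent_subseq[OF K c D])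
  then show "l \<in> range ?T" by blast
qed

text \<open>Riesz's argument: pulling a nonzero kernel vector back \<open>n\<close> times shows that
  the kernels \<open>N n\<close> of the powers increase strictly. Unit vectors of
  \<open>N (Suc n)\<close> far from \<open>N n\<close> then have images under \<open>K\<close>
  without a Cauchy subsequence.\<close>

lemma compact_shift_surj_imp_inj:
  fixes K :: "'a::real_normed_vector \<Rightarrow> 'a"
  assumes K: "compact_op K" and c: "c \<noteq> 0" and surj: "surj (shift_op c K)"
    and x0: "shift_op c K x0 = 0"
  shows "x0 = 0"
proof (rule ccontr)
  assume "x0 \<noteq> 0"
  let ?T = "shift_op c K"
  have bl: "bounded_linear ?T"
    by (rule bounded_linear_shift_op[OF compact_op_bounded_linear[OF K]])
  have bln: "bounded_linear (?T ^^ n)" for n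
    by (induction n) (use bl bounded_linear_compose in \<open>auto simp: id_def o_def\<close>)
  then have lin: "linear (?T ^^ n)" for n by (rule bounded_linear.linear)
  define N where "N n = {x. (?T ^^ n) x = 0}" for n
  have closed: "closed (N n)" for n
    unfolding N_def using bln by (intro closed_Collect_eq) (auto intro: linear_continuous_on)
  have sub: "subspace (N n)" for n
    unfolding N_def using lin by (rule linear_subspace_kernel)
  have step: "N n \<subseteq> N (Suc n)" for n
    using linear_0[OF lin[of 1]] by (auto simp: N_def)
  then have mono: "N m \<subseteq> N n" if "m \<le> n" for m n
    using that by (rule lift_Suc_mono_le)
  have TN: "?T x \<in> N n" if "x \<in> N (Suc n)" for x n
    using that by (simp add: N_def funpow_swap1)
  have "\<exists>u\<in>N (Suc n). norm u = 1 \<and> (\<forall>v\<in>N n. 1 / 2 \<le> norm (u - v))" for n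
  proof -
    have "surj (?T ^^ n)" using surj by (rule surj_fn)
    then obtain x where x: "(?T ^^ n) x = x0" by (metis surjD)
    then have "x \<notin> N n" "x \<in> N (Suc n)" using \<open>x0 \<noteq> 0\<close> x0 by (auto simp: N_def)
    obtain y where y: "y \<in> N n" "\<And>z. z \<in> N n \<Longrightarrow> norm (x - y) \<le> 2 * norm (x - z)"
      using almost_best_approximation[OF closed[of n], of x] sub subspace_0 by blast
    define w where "w = x - y"
    have pos: "norm w > 0" using \<open>x \<notin> N n\<close> y(1) by (auto simp: w_def)
    show ?thesis
    proof (intro bexI conjI ballI)
      show "norm ((1 / norm w) *\<^sub>R w) = 1" using pos by simp
      show "(1 / norm w) *\<^sub>R w \<in> N (Suc n)"
        unfolding w_def using sub step \<open>x \<in> N (Suc n)\<close> y(1)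
        by (intro subspace_scale subspace_diff) auto
      fix v assume "v \<in> N n"
      then have "norm w \<le> 2 * norm (x - (y + norm w *\<^sub>R v))"
        unfolding w_def using y(1) sub by (intro y(2) subspace_add subspace_scale) auto
      also have "x - (y + norm w *\<^sub>R v) = norm w *\<^sub>R ((1 / norm w) *\<^sub>R w - v)"
        using pos by (simp add: w_def algebra_simps)
      finally show "1 / 2 \<le> norm ((1 / norm w) *\<^sub>R w - v)"
        using pos by simp
    qed
  qed
  then obtain u where u: "\<And>n. u n \<in> N (Suc n)" "\<And>n. norm (u n) = 1"
    and far: "\<And>n v. v \<in> N n \<Longrightarrow> 1 / 2 \<le> norm (u n - v)"
    by metis
  have sep: "\<bar>c\<bar> / 2 \<le> norm (K (u n) - K (u m))" if "m < n" for m n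
  proof -
    \<comment> \<open>Solves \<open>K (u n) - K (u m) = c *\<^sub>R (u n - v)\<close>. All terms of
      \<open>v\<close> lie in \<open>N n\<close>, because \<open>?T\<close> lowers the index of a
      kernel by one and \<open>m < n\<close>.\<close>
    define v where "v = (1 / c) *\<^sub>R (?T (u n) - ?T (u m)) + u m"
    have "u m \<in> N n" "?T (u n) \<in> N n" "?T (u m) \<in> N n"
      using u(1) TN mono[of "Suc m" n] mono[of m n] that by (auto simp: subset_iff)
    then have "v \<in> N n"
      unfolding v_def using sub by (intro subspace_add subspace_scale subspace_diff) auto
    then have "\<bar>c\<bar> / 2 \<le> \<bar>c\<bar> * norm (u n - v)"
      using mult_left_mono[OF far abs_ge_zero[of c]] by simp
    also have "\<dots> = norm (c *\<^sub>R (u n - v))" by simp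
    also have "c *\<^sub>R (u n - v) = K (u n) - K (u m)"
      using c by (simp add: v_def shift_op_def algebra_simps)
    finally show ?thesis .
  qed
  obtain l r where r: "strict_mono (r :: nat \<Rightarrow> nat)" "(\<lambda>n. K (u (r n))) \<longlonglongrightarrow> l"
    using compact_op_convergent_subseq[OF K, of u 1] u(2) by (metis order_refl)
  then have "Cauchy (\<lambda>n. K (u (r n)))" using LIMSEQ_imp_Cauchy by blast
  moreover have "\<bar>c\<bar> / 2 > 0" using c by simp
  ultimately obtain M where "\<And>m n. M \<le> m \<Longrightarrow> M \<le> n \<Longrightarrow> norm (K (u (r m)) - K (u (r n))) < \<bar>c\<bar> / 2"
    unfolding Cauchy_iff by blast
  from this[of "Suc M" M] sep[of "r M" "r (Suc M)"] strict_monoD[OF r(1), of M "Suc M"]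
  show False by simp
qed

subsection \<open>Neumann series and positive resolvents\<close>

lemma linear_funpow:
  fixes A :: "'b::real_vector \<Rightarrow> 'b"
  assumes "linear A"
  shows "linear (A ^^ n)"
proof (induction n)
  case (Suc n)
  then show ?case using linear_compose[OF Suc assms] by (simp only: funpow.simps)
qed (simp add: linear_id[unfolded id_def])

text \<open>The bound is on the powers, so \<open>A\<close> itself may have norm above 1. Both
  one-sided equations are recorded for the bijectivity needed on the complexification, to which the
  lemma is applied as a Banach space of pairs.\<close>

lemma neumann_series:
  fixes A :: "'b::banach \<Rightarrow> 'b"
  assumes A: "bounded_linear A" and q: "0 \<le> q" "q < 1"
    and bound: "\<And>n x. norm ((A ^^ n) x) \<le> C * q ^ n * norm x"
  shows "\<exists>S. bounded_linear S \<and> (\<forall>x. (\<lambda>n. (A ^^ n) x) sums S x) \<and>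
    (\<forall>x. S x - A (S x) = x) \<and> (\<forall>x. S x - S (A x) = x)"
proof -
  define S where "S x = (\<Sum>n. (A ^^ n) x)" for x
  have lin: "linear (A ^^ n)" for n
    using A by (intro linear_funpow bounded_linear.linear)
  have geo: "(\<lambda>n. C * q ^ n * norm x) sums (C * (1 / (1 - q)) * norm x)" for x :: 'b
    using q by (intro sums_mult sums_mult2 geometric_sums) auto
  have summ_norm: "summable (\<lambda>n. norm ((A ^^ n) x))" for x
    using bound by (intro summable_comparison_test'[OF sums_summable[OF geo], of 0]) simp
  then have summ: "summable (\<lambda>n. (A ^^ n) x)" for x
    by (rule summable_norm_cancel)
  then have S: "(\<lambda>n. (A ^^ n) x) sums S x" for x
    unfolding S_def by (rule summable_sums)
  have bl: "bounded_linear S"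
  proof (rule bounded_linear_intro)
    fix x y :: 'b and c :: real
    show "S (x + y) = S x + S y"
      using sums_add[OF S[of x] S[of y]]
      by (intro sums_unique2[OF S]) (simp add: linear_add[OF lin])
    show "S (c *\<^sub>R x) = c *\<^sub>R S x"
      using sums_scaleR_right[OF S[of x], of c]
      by (intro sums_unique2[OF S]) (simp add: linear_scale[OF lin])
    have "norm (S x) \<le> (\<Sum>n. norm ((A ^^ n) x))"
      unfolding S_def by (rule summable_norm[OF summ_norm])
    also have "\<dots> \<le> (\<Sum>n. C * q ^ n * norm x)"
      by (intro suminf_le bound summ_norm sums_summable[OF geo])
    also have "\<dots> = norm x * (C * (1 / (1 - q)))"
      using sums_unique[OF geo, of x] by (simp add: mult.commute)
    finally show "norm (S x) \<le> norm x * (C * (1 / (1 - q)))" .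
  qed
  have right: "S x - A (S x) = x" for x
  proof -
    have "(\<lambda>n. (A ^^ Suc n) x) sums A (S x)"
      using bounded_linear.sums[OF A S] by simp
    from sums_Suc[OF this] have "(\<lambda>n. (A ^^ n) x) sums (A (S x) + x)" by simp
    then have "S x = A (S x) + x" by (rule sums_unique2[OF S])
    then show ?thesis by (metis add_diff_cancel_left')
  qed
  have left: "S x - S (A x) = x" for x
  proof -
    have "(\<lambda>n. (A ^^ Suc n) x) sums S (A x)"
      using S[of "A x"] by (simp add: funpow_swap1)
    from sums_Suc[OF this] have "(\<lambda>n. (A ^^ n) x) sums (S (A x) + x)" by simp
    then have "S x = S (A x) + x" by (rule sums_unique2[OF S])
    then show ?thesis by (metis add_diff_cancel_left')
  qed
  show ?thesis
    by (intro exI[of _ S] conjI allI bl S right left)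
qed

lemma neumann_series_nonneg:
  fixes A :: "'a::banach_lattice \<Rightarrow> 'a"
  assumes A: "bounded_linear A" and q: "0 \<le> q" "q < 1"
    and bound: "\<And>n x. norm ((A ^^ n) x) \<le> C * q ^ n * norm x"
    and pos: "\<And>x. 0 \<le> x \<Longrightarrow> 0 \<le> A x"
  shows "\<exists>S. bounded_linear S \<and> (\<forall>x\<ge>0. 0 \<le> S x) \<and> (\<forall>x. S x - A (S x) = x)"
proof -
  obtain S where S: "bounded_linear S" "\<And>x. (\<lambda>n. (A ^^ n) x) sums S x"
    "\<And>x. S x - A (S x) = x"
    using neumann_series[OF A q bound] by blast
  have "0 \<le> S x" if "0 \<le> x" for x
  proof (rule limit_nonneg)
    show "(\<lambda>n. \<Sum>i<n. (A ^^ i) x) \<longlonglongrightarrow> S x"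
      using S(2) by (simp add: sums_def)
    have "0 \<le> (A ^^ i) x" for i
      by (induction i) (simp_all add: that pos)
    then show "0 \<le> (\<Sum>i<n. (A ^^ i) x)" for n by (rule sum_nonneg)
  qed
  then show ?thesis
    by (intro exI[of _ S] conjI allI impI S)
qed

definition growth_bounded :: "('a::real_normed_vector \<Rightarrow> 'a) \<Rightarrow> real \<Rightarrow> bool" where
  "growth_bounded A \<mu> \<longleftrightarrow> (\<exists>C. \<forall>n x. norm ((A ^^ n) x) \<le> C * \<mu> ^ n * norm x)"

text \<open>A right inverse is what continuation below \<open>r\<close> produces directly, and it
  suffices to dominate the powers of \<open>M\<close>.\<close>

definition has_positive_resolvent :: "('a::banach_lattice \<Rightarrow> 'a) \<Rightarrow> real \<Rightarrow> bool" where
  "has_positive_resolvent M \<mu> \<longleftrightarrow>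
     (\<exists>S. bounded_linear S \<and> (\<forall>x\<ge>0. 0 \<le> S x) \<and> (\<forall>x. shift_op \<mu> M (S x) = x))"

text \<open>The resolvent is the Neumann series of \<open>M\<close> divided by \<open>\<mu>\<close>,
  up to the factor \<open>1 / \<mu>\<close>; the gap between \<open>\<nu>\<close> and
  \<open>\<mu>\<close> gives the ratio \<open>\<nu> / \<mu> < 1\<close>.\<close>

lemma positive_resolvent_above_growth:
  fixes M :: "'a::banach_lattice \<Rightarrow> 'a"
  assumes M: "bounded_linear M" and pos: "\<And>x. 0 \<le> x \<Longrightarrow> 0 \<le> M x"
    and growth: "growth_bounded M \<nu>" and "0 < \<nu>" "\<nu> < \<mu>"
  shows "has_positive_resolvent M \<mu>"
proof -
  obtain C where C: "\<And>n x. norm ((M ^^ n) x) \<le> C * \<nu> ^ n * norm x"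
    using growth by (auto simp: growth_bounded_def)
  have lin: "linear M" using M by (rule bounded_linear.linear)
  define A where "A x = (1 / \<mu>) *\<^sub>R M x" for x
  have "(A ^^ n) x = (1 / \<mu> ^ n) *\<^sub>R (M ^^ n) x" for n x
    by (induction n) (auto simp: A_def linear_scale[OF lin])
  then have "norm ((A ^^ n) x) \<le> C * (\<nu> / \<mu>) ^ n * norm x" for n x
    using C[of n x] assms(4,5) by (simp add: power_divide field_simps)
  moreover have "bounded_linear A"
    unfolding A_def using M by (rule bounded_linear_scaleR_right[THEN bounded_linear_compose])
  moreover have "0 \<le> A x" if "0 \<le> x" for x
    unfolding A_def using pos[OF that] assms(4,5) by (intro scaleR_nonneg_nonneg) auto
  moreover have "0 \<le> \<nu> / \<mu>" "\<nu> / \<mu> < 1" using assms(4,5) by auto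
  ultimately obtain S where S: "bounded_linear S" "\<And>x. 0 \<le> x \<Longrightarrow> 0 \<le> S x" "\<And>x. S x - A (S x) = x"
    using neumann_series_nonneg[of A "\<nu> / \<mu>" C] by metis
  show ?thesis
    unfolding has_positive_resolvent_def
  proof (intro exI[of _ "\<lambda>x. (1 / \<mu>) *\<^sub>R S x"] conjI allI impI)
    show "bounded_linear (\<lambda>x. (1 / \<mu>) *\<^sub>R S x)"
      using S(1) by (rule bounded_linear_scaleR_right[THEN bounded_linear_compose])
    show "0 \<le> (1 / \<mu>) *\<^sub>R S x" if "0 \<le> x" for x
      using S(2)[OF that] assms(4,5) by (intro scaleR_nonneg_nonneg) auto
    show "shift_op \<mu> M ((1 / \<mu>) *\<^sub>R S x) = x" for x
      using S(3)[of x] assms(4,5) by (simp add: A_def shift_op_def linear_scale[OF lin])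
  qed
qed

text \<open>For \<open>x \<ge> 0\<close>, the identity
  \<open>M (S x) = \<mu> *\<^sub>R S x - x\<close> yields both
  \<open>x \<le> \<mu> *\<^sub>R S x\<close> and \<open>M (S x) \<le> \<mu> *\<^sub>R S x\<close>.
  Iterating the second from the first dominates all powers by the single bounded operator
  \<open>S\<close>.\<close>

lemma growth_bounded_of_positive_resolvent:
  fixes M :: "'a::banach_lattice \<Rightarrow> 'a"
  assumes lin: "linear M" and pos: "\<And>x. 0 \<le> x \<Longrightarrow> 0 \<le> M x"
    and res: "has_positive_resolvent M \<mu>" and "0 < \<mu>"
  shows "growth_bounded M \<mu>"
proof -
  obtain S where S: "bounded_linear S" "\<And>x. 0 \<le> x \<Longrightarrow> 0 \<le> S x"
    and eq: "\<And>x. shift_op \<mu> M (S x) = x"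
    using res unfolding has_positive_resolvent_def by blast
  have MS: "M (S x) = \<mu> *\<^sub>R S x - x" for x
    using eq[of x] by (simp add: shift_op_def algebra_simps)
  have mono: "M x \<le> M y" if "x \<le> y" for x y
    using pos[of "y - x"] that by (simp add: linear_diff[OF lin])
  have pow: "linear (M ^^ n)" for n
    using lin by (rule linear_funpow)
  have pow_pos: "0 \<le> (M ^^ n) x" if "0 \<le> x" for n x
    by (induction n) (simp_all add: that pos)
  have dom: "(M ^^ n) x \<le> \<mu> ^ Suc n *\<^sub>R S x" if "0 \<le> x" for n x
  proof (induction n)
    case 0
    show ?case using pos[OF S(2)[OF that]] by (simp add: MS)
  next
    case (Suc n)
    have "(M ^^ Suc n) x \<le> \<mu> ^ Suc n *\<^sub>R M (S x)"
      using mono[OF Suc] by (simp only: linear_scale[OF lin] funpow.simps o_apply)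
    also have "M (S x) \<le> \<mu> *\<^sub>R S x" using that by (simp add: MS)
    then have "\<mu> ^ Suc n *\<^sub>R M (S x) \<le> \<mu> ^ Suc n *\<^sub>R (\<mu> *\<^sub>R S x)"
      using \<open>0 < \<mu>\<close> by (intro scaleR_left_mono) auto
    finally show ?case by (simp add: ac_simps)
  qed
  obtain B where B: "\<And>x. norm (S x) \<le> norm x * B"
    using bounded_linear.bounded[OF S(1)] by blast
  have "norm ((M ^^ n) x) \<le> (\<mu> * B) * \<mu> ^ n * norm x" for n x
  proof -
    let ?a = "sup x (- x)"
    \<comment> \<open>The modulus has the norm of \<open>x\<close>, so passing to positive vectors
      costs nothing.\<close>
    have "norm ((M ^^ n) x) \<le> norm ((M ^^ n) ?a)"
    proof (rule norm_le_of_modulus_le)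
      have "0 \<le> (M ^^ n) (?a - x)" "0 \<le> (M ^^ n) (?a - (- x))"
        by (intro pow_pos; simp only: diff_ge_0_iff_ge sup_ge1 sup_ge2)+
      then show "(M ^^ n) x \<le> (M ^^ n) ?a" "- (M ^^ n) x \<le> (M ^^ n) ?a"
        by (simp_all only: linear_diff[OF pow] linear_neg[OF pow] diff_ge_0_iff_ge)
    qed
    also have "\<dots> \<le> norm (\<mu> ^ Suc n *\<^sub>R S ?a)"
      by (intro lattice_norm_mono pow_pos dom modulus_nonneg)
    also have "\<dots> = \<mu> ^ Suc n * norm (S ?a)" using \<open>0 < \<mu>\<close> by simp
    also have "\<dots> \<le> \<mu> ^ Suc n * (norm ?a * B)"
      using \<open>0 < \<mu>\<close> by (intro mult_left_mono B) auto
    finally show ?thesis by (simp add: norm_modulus ac_simps)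
  qed
  then show ?thesis unfolding growth_bounded_def by blast
qed

text \<open>A lower bound on \<open>r - M\<close> keeps the resolvents at \<open>r + t\<close> bounded as \<open>t\<close> tends to \<open>0\<close>,
  so the expansion of the resolvent around \<open>r + t\<close>, whose terms are positive, reaches below \<open>r\<close>.\<close>

lemma positive_resolvent_below:
  fixes M :: "'a::banach_lattice \<Rightarrow> 'a"
  assumes M: "bounded_linear M" and "0 < r"
    and res: "\<And>\<mu>. r < \<mu> \<Longrightarrow> has_positive_resolvent M \<mu>"
    and b: "0 < b" "\<And>x. b * norm x \<le> norm (shift_op r M x)"
  obtains \<mu> where "0 < \<mu>" "\<mu> < r" "has_positive_resolvent M \<mu>"
proof -
  \<comment> \<open>The lower bound gives \<open>(b - t) * norm (S x) \<le> norm x\<close>; with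
    \<open>t \<le> b / 4\<close> this makes \<open>2 * t\<close> times \<open>S\<close> a
    contraction of factor \<open>2/3\<close>. The term \<open>r / 2\<close> keeps
    \<open>r - t\<close> positive.\<close>
  define t where "t = min (b / 4) (r / 2)"
  have t: "0 < t" "t \<le> b / 4" "t < r" using b \<open>0 < r\<close> by (auto simp: t_def)
  obtain S where S: "bounded_linear S" "\<And>x. 0 \<le> x \<Longrightarrow> 0 \<le> S x"
    and eq: "\<And>x. shift_op (r + t) M (S x) = x"
    using res[of "r + t"] t(1) unfolding has_positive_resolvent_def by auto
  have linS: "linear S" and linM: "linear M"
    using S(1) M by (auto intro: bounded_linear.linear)
  \<comment> \<open>The points \<open>r + t\<close> and \<open>r - t\<close> differ by
    \<open>2 * t\<close>, so the resolvent at \<open>r - t\<close> is \<open>S\<close> composed with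
    the Neumann series of \<open>A\<close>.\<close>
  define A where "A x = (2 * t) *\<^sub>R S x" for x
  have q: "norm (A x) \<le> (2/3) * norm x" for x
  proof -
    have "shift_op r M (S x) = shift_op (r + t) M (S x) - t *\<^sub>R S x"
      by (simp add: shift_op_def algebra_simps)
    then have "shift_op r M (S x) = x - t *\<^sub>R S x"
      by (simp add: eq)
    then have "b * norm (S x) \<le> norm x + t * norm (S x)"
      using b(2)[of "S x"] norm_triangle_ineq4[of x "t *\<^sub>R S x"] t(1) by simp
    moreover have "4 * t * norm (S x) \<le> b * norm (S x)"
      using t by (intro mult_right_mono) auto
    ultimately show ?thesis using t(1) by (simp add: A_def)
  qed
  have "norm ((A ^^ n) x) \<le> 1 * (2/3) ^ n * norm x" for n x
  proof (induction n)
    case (Suc n)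
    then show ?case using q[of "(A ^^ n) x"] by simp
  qed simp
  moreover have "bounded_linear A"
    unfolding A_def using S(1) by (rule bounded_linear_scaleR_right[THEN bounded_linear_compose])
  moreover have "0 \<le> A x" if "0 \<le> x" for x
    unfolding A_def using S(2)[OF that] t(1) by (intro scaleR_nonneg_nonneg) auto
  ultimately obtain Q where Q: "bounded_linear Q" "\<And>x. 0 \<le> x \<Longrightarrow> 0 \<le> Q x"
    "\<And>x. Q x - A (Q x) = x"
    using neumann_series_nonneg[of A "2/3" 1] by force
  have "shift_op (r - t) M (S (Q x)) = x" for x
  proof -
    have "shift_op (r - t) M (S (Q x)) = shift_op (r + t) M (S (Q x)) - A (Q x)"
      by (simp add: shift_op_def A_def algebra_simps flip: scaleR_2)
    then show ?thesis by (simp add: eq Q(3))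
  qed
  then have "has_positive_resolvent M (r - t)"
    unfolding has_positive_resolvent_def
    using S Q(1,2) by (intro exI[of _ "\<lambda>x. S (Q x)"]) (auto intro: bounded_linear_compose)
  with t show thesis by (intro that[of "r - t"]) auto
qed

subsection \<open>The growth radius and the spectrum\<close>

text \<open>Multiplication of x + i y by \<open>w\<close>, in the pair encoding of
  \<open>op_spectrum\<close>.\<close>

definition complex_scale :: "complex \<Rightarrow> 'a::real_vector \<times> 'a \<Rightarrow> 'a \<times> 'a" where
  "complex_scale w p = (Re w *\<^sub>R fst p - Im w *\<^sub>R snd p, Re w *\<^sub>R snd p + Im w *\<^sub>R fst p)"

lemma complex_scale_mult: "complex_scale w (complex_scale u p) = complex_scale (w * u) p"
  by (simp add: complex_scale_def algebra_simps)

lemma complex_scale_one: "complex_scale 1 p = p"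
  by (simp add: complex_scale_def)

lemma linear_complex_scale: "linear (complex_scale w)"
  by (intro linearI) (simp_all add: complex_scale_def algebra_simps)

text \<open>The norm on pairs need not be homogeneous for complex scalars; the \<open>4\<close>
  counts the four real products.\<close>

lemma norm_complex_scale_le:
  fixes p :: "'a::real_normed_vector \<times> 'a"
  shows "norm (complex_scale w p) \<le> 4 * cmod w * norm p"
proof -
  obtain x y where p: "p = (x, y)" by fastforce
  have *: "norm (r *\<^sub>R z) \<le> cmod w * norm p" if "\<bar>r\<bar> \<le> cmod w" "norm z \<le> norm p" for r and z :: 'a
    using that by (simp add: mult_mono)
  have xy: "norm x \<le> norm p" "norm y \<le> norm p"
    using norm_fst_le[of x y] norm_snd_le[of y x] by (auto simp: p)
  note b = abs_Re_le_cmod abs_Im_le_cmod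
  have "norm (complex_scale w p) \<le>
      norm (Re w *\<^sub>R x - Im w *\<^sub>R y) + norm (Re w *\<^sub>R y + Im w *\<^sub>R x)"
    unfolding complex_scale_def p fst_conv snd_conv by (rule norm_Pair_le)
  also have "\<dots> \<le> (norm (Re w *\<^sub>R x) + norm (Im w *\<^sub>R y)) + (norm (Re w *\<^sub>R y) + norm (Im w *\<^sub>R x))"
    by (intro add_mono norm_triangle_ineq norm_triangle_ineq4)
  also have "\<dots> \<le> (cmod w * norm p + cmod w * norm p) + (cmod w * norm p + cmod w * norm p)"
    by (intro add_mono * b xy)
  finally show ?thesis by simp
qed

text \<open>On pairs, with \<open>A\<close> the complexified \<open>M\<close> divided by
  \<open>z\<close>, the map in \<open>op_spectrum\<close> is \<open>z\<close> times
  \<open>A - 1\<close>. Beyond \<open>\<nu>\<close> the Neumann series \<open>S\<close> of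
  \<open>A\<close> converges, so division by \<open>z\<close> followed by \<open>- S\<close> inverts
  it.\<close>

lemma op_spectrum_growth_bound:
  fixes M :: "'a::banach \<Rightarrow> 'a"
  assumes M: "bounded_linear M" and growth: "growth_bounded M \<nu>" and "0 < \<nu>"
    and z: "z \<in> op_spectrum M"
  shows "cmod z \<le> \<nu>"
proof (rule ccontr)
  assume "\<not> ?thesis"
  then have less: "\<nu> < cmod z" by simp
  then have z0: "z \<noteq> 0" using \<open>0 < \<nu>\<close> by auto
  define w where "w = inverse z"
  obtain C where C: "\<And>n x. norm ((M ^^ n) x) \<le> C * \<nu> ^ n * norm x"
    using growth by (auto simp: growth_bounded_def)
  have linM: "linear M" using M by (rule bounded_linear.linear)
  define A where "A p = complex_scale w (M (fst p), M (snd p))" for p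
  have linA: "linear A"
    by (intro linearI)
      (simp_all add: A_def complex_scale_def linear_add[OF linM] linear_scale[OF linM] algebra_simps)
  \<comment> \<open>Collecting the scalars into \<open>w ^ n\<close> means that the factor 4 is paid
    once and not \<open>n\<close> times.\<close>
  have power: "(A ^^ n) p = complex_scale (w ^ n) ((M ^^ n) (fst p), (M ^^ n) (snd p))" for n p
  proof (induction n)
    case 0
    show ?case by (simp add: complex_scale_one)
  next
    case (Suc n)
    define q where "q = ((M ^^ n) (fst p), (M ^^ n) (snd p))"
    have "(A ^^ Suc n) p = A (complex_scale (w ^ n) q)"
      by (simp add: Suc q_def)
    also have "\<dots> = complex_scale w (complex_scale (w ^ n) (M (fst q), M (snd q)))"
      by (simp add: A_def complex_scale_def linear_add[OF linM] linear_diff[OF linM]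
          linear_scale[OF linM])
    finally show ?case by (simp add: complex_scale_mult q_def)
  qed
  \<comment> \<open>The \<open>8\<close> is the factor 4 times the two components of a pair;
    \<open>\<bar>C\<bar>\<close> covers an unknown sign of \<open>C\<close>.\<close>
  have bound: "norm ((A ^^ n) p) \<le> (8 * \<bar>C\<bar>) * (\<nu> / cmod z) ^ n * norm p" for n p
  proof -
    have le: "norm ((M ^^ n) x) \<le> \<bar>C\<bar> * \<nu> ^ n * norm p" if "norm x \<le> norm p" for x
    proof -
      have "C * \<nu> ^ n * norm x \<le> \<bar>C\<bar> * \<nu> ^ n * norm p"
        using \<open>0 < \<nu>\<close> that by (intro mult_mono) auto
      with C show ?thesis by (rule order_trans)
    qed
    have "norm ((A ^^ n) p) \<le> 4 * cmod (w ^ n) * norm ((M ^^ n) (fst p), (M ^^ n) (snd p))"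
      unfolding power by (rule norm_complex_scale_le)
    also have "norm ((M ^^ n) (fst p), (M ^^ n) (snd p)) \<le>
        \<bar>C\<bar> * \<nu> ^ n * norm p + \<bar>C\<bar> * \<nu> ^ n * norm p"
      using norm_fst_le[of "fst p" "snd p"] norm_snd_le[of "snd p" "fst p"]
      by (intro order_trans[OF norm_Pair_le] add_mono le) simp_all
    also have "4 * cmod (w ^ n) * (\<bar>C\<bar> * \<nu> ^ n * norm p + \<bar>C\<bar> * \<nu> ^ n * norm p) =
        (8 * \<bar>C\<bar>) * (\<nu> / cmod z) ^ n * norm p"
      by (simp add: w_def norm_power norm_inverse power_mult_distrib divide_inverse power_inverse)
    finally show ?thesis by (simp add: mult_left_mono)
  qed
  have "bounded_linear A"
    using bound[of 1] linA
    by (intro bounded_linear_intro[where K = "(8 * \<bar>C\<bar>) * (\<nu> / cmod z)"])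
      (simp_all add: linear_add linear_scale mult.commute)
  moreover have "0 \<le> \<nu> / cmod z" "\<nu> / cmod z < 1"
    using \<open>0 < \<nu>\<close> less z0 by (simp_all add: divide_less_eq)
  ultimately obtain S where S: "bounded_linear S" "\<And>p. S p - A (S p) = p" "\<And>p. S p - S (A p) = p"
    using neumann_series[OF _ _ _ bound] by metis
  have linS: "linear S" using S(1) by (rule bounded_linear.linear)
  define T where "T = (\<lambda>(x, y). (M x - Re z *\<^sub>R x + Im z *\<^sub>R y, M y - Im z *\<^sub>R x - Re z *\<^sub>R y))"
  have zw: "z * w = 1" "w * z = 1" using z0 by (simp_all add: w_def)
  have T: "T p = complex_scale z (A p - p)" for p
  proof -
    have "complex_scale z (A p) = (M (fst p), M (snd p))"
      by (simp add: A_def complex_scale_mult zw complex_scale_one)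
    then have "complex_scale z (A p - p) = (M (fst p), M (snd p)) - complex_scale z p"
      by (simp add: linear_diff[OF linear_complex_scale])
    then show ?thesis by (simp add: T_def complex_scale_def split_beta algebra_simps)
  qed
  have "bij T"
  proof (rule o_bij)
    show "(\<lambda>p. - S (complex_scale w p)) \<circ> T = id"
    proof
      fix p :: "'a \<times> 'a"
      have "complex_scale w (T p) = A p - p"
        by (simp add: T complex_scale_mult zw complex_scale_one)
      then show "((\<lambda>p. - S (complex_scale w p)) \<circ> T) p = id p"
        using S(3)[of p] by (simp add: linear_diff[OF linS])
    qed
    show "T \<circ> (\<lambda>p. - S (complex_scale w p)) = id"
    proof
      fix p :: "'a \<times> 'a"
      define u where "u = complex_scale w p"
      have "A (- S u) - (- S u) = u"
        using S(2)[of u] by (simp add: linear_neg[OF linA])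
      then show "(T \<circ> (\<lambda>p. - S (complex_scale w p))) p = id p"
        by (simp add: T u_def complex_scale_mult zw complex_scale_one)
    qed
  qed
  then show False using z by (simp add: op_spectrum_def T_def)
qed

text \<open>For bounded \<open>A\<close> this is the limit of the n-th roots of the operator norms
  of the powers, in a form that yields upper bounds on orbits at once.\<close>

definition growth_radius :: "('a::real_normed_vector \<Rightarrow> 'a) \<Rightarrow> real" where
  "growth_radius A = Inf {\<mu>. 0 < \<mu> \<and> growth_bounded A \<mu>}"

lemma growth_bounded_exists:
  assumes "bounded_linear A"
  shows "\<exists>\<mu>>0. growth_bounded A \<mu>"
proof -
  obtain K where K: "K > 0" "\<And>x. norm (A x) \<le> norm x * K"
    using bounded_linear.pos_bounded[OF assms] by blast
  have "norm ((A ^^ n) x) \<le> 1 * K ^ n * norm x" for n x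
  proof (induction n)
    case (Suc n)
    have "norm ((A ^^ Suc n) x) \<le> norm ((A ^^ n) x) * K" using K(2) by simp
    also have "\<dots> \<le> 1 * K ^ n * norm x * K" using Suc K(1) by (intro mult_right_mono) auto
    finally show ?case by (simp add: ac_simps)
  qed simp
  then show ?thesis using K(1) unfolding growth_bounded_def by blast
qed

lemma growth_radius_nonneg:
  assumes "bounded_linear A"
  shows "0 \<le> growth_radius A"
  unfolding growth_radius_def
  using growth_bounded_exists[OF assms] by (intro cInf_greatest) auto

lemma growth_radius_le: "0 < \<mu> \<Longrightarrow> growth_bounded A \<mu> \<Longrightarrow> growth_radius A \<le> \<mu>"
  unfolding growth_radius_def by (intro cInf_lower bdd_belowI[where m = 0]) auto

lemma growth_bounded_above_radius:
  assumes "bounded_linear A" "growth_radius A < \<mu>"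
  obtains \<nu> where "0 < \<nu>" "\<nu> < \<mu>" "growth_bounded A \<nu>"
  using cInf_lessD[of "{\<mu>. 0 < \<mu> \<and> growth_bounded A \<mu>}" \<mu>] assms growth_bounded_exists
  unfolding growth_radius_def by blast

lemma op_spectrum_le_growth_radius:
  fixes M :: "'a::banach \<Rightarrow> 'a"
  assumes M: "bounded_linear M" and z: "z \<in> op_spectrum M"
  shows "cmod z \<le> growth_radius M"
proof (rule dense_le)
  fix \<mu> assume "\<mu> < cmod z"
  show "\<mu> \<le> growth_radius M"
  proof (rule ccontr)
    assume "\<not> ?thesis"
    then obtain \<nu> where "0 < \<nu>" "\<nu> < \<mu>" "growth_bounded M \<nu>"
      using growth_bounded_above_radius[OF M, of \<mu>] by auto
    then show False
      using op_spectrum_growth_bound[OF M _ _ z, of \<nu>] \<open>\<mu> < cmod z\<close> by simp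
  qed
qed

lemma growth_radius_eigenvector:
  fixes M :: "'a::banach_lattice \<Rightarrow> 'a"
  assumes M: "compact_op M" and pos: "\<And>x. 0 \<le> x \<Longrightarrow> 0 \<le> M x" and r: "0 < growth_radius M"
  shows "\<exists>x. x \<noteq> 0 \<and> shift_op (growth_radius M) M x = 0"
proof (rule ccontr)
  assume neg: "\<not> ?thesis"
  let ?r = "growth_radius M"
  have bl: "bounded_linear M" using M by (rule compact_op_bounded_linear)
  have res: "has_positive_resolvent M \<mu>" if "?r < \<mu>" for \<mu>
    using growth_bounded_above_radius[OF bl that] positive_resolvent_above_growth[OF bl pos]
    by metis
  obtain b where b: "b > 0" "\<And>x. b * norm x \<le> norm (shift_op ?r M x)"
    using compact_shift_bounded_below[OF M, of ?r] neg r by (metis less_irrefl)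
  obtain \<mu> where \<mu>: "0 < \<mu>" "\<mu> < ?r" "has_positive_resolvent M \<mu>"
    using positive_resolvent_below[OF bl r res b] by blast
  then have "growth_bounded M \<mu>"
    using growth_bounded_of_positive_resolvent[OF bounded_linear.linear[OF bl] pos] by blast
  then show False using growth_radius_le \<mu>(1,2) by force
qed

lemma spectral_radius_eq_growth_radius:
  fixes M :: "'a::banach_lattice \<Rightarrow> 'a"
  assumes M: "compact_op M" and pos: "\<And>x. 0 \<le> x \<Longrightarrow> 0 \<le> M x"
  shows "spectral_radius M = growth_radius M"
proof -
  let ?r = "growth_radius M"
  have bl: "bounded_linear M" using M by (rule compact_op_bounded_linear)
  have le: "cmod z \<le> ?r" if "z \<in> op_spectrum M" for z
    using op_spectrum_le_growth_radius[OF bl that] .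
  show ?thesis
  proof (cases "?r = 0")
    case True
    \<comment> \<open>The spectrum lies in {0}; if it is empty, the convention in
      \<open>spectral_radius\<close> supplies the value \<open>0\<close>.\<close>
    have "cmod ` op_spectrum M = {0}" if "op_spectrum M \<noteq> {}"
      using le that True by fastforce
    then show ?thesis using True by (simp add: spectral_radius_def)
  next
    case False
    then have r: "0 < ?r" using growth_radius_nonneg[OF bl] by simp
    obtain x where x: "x \<noteq> 0" "shift_op ?r M x = 0"
      using growth_radius_eigenvector[OF M pos r] by blast
    define T where "T = (\<lambda>(x, y). (M x - Re (of_real ?r) *\<^sub>R x + Im (of_real ?r) *\<^sub>R y,
      M y - Im (of_real ?r) *\<^sub>R x - Re (of_real ?r) *\<^sub>R y))"
    \<comment> \<open>The real eigenvector is read as x + i 0.\<close>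
    have "T (x, 0) = T (0, 0)"
      using x(2) linear_0[OF bounded_linear.linear[OF bl]] by (simp add: T_def shift_op_def)
    then have "\<not> inj T" using x(1) by (auto dest: injD)
    then have spec: "of_real ?r \<in> op_spectrum M"
      by (auto simp: op_spectrum_def T_def bij_def)
    moreover have "Sup (cmod ` op_spectrum M) = ?r"
    proof (rule cSup_eq_maximum)
      show "?r \<in> cmod ` op_spectrum M"
        using spec r by (intro image_eqI[of _ _ "of_real ?r"]) auto
    qed (use le in auto)
    ultimately show ?thesis by (auto simp: spectral_radius_def)
  qed
qed

section \<open>Lower bound on the orbit of \<open>h\<close>\<close>

text \<open>Modulo the range of \<open>r - M\<close> the operator \<open>M\<close> acts as multiplication by \<open>r\<close>, so
  \<open>dist (M\<^sup>n y) Y = r\<^sup>n dist y Y\<close> for the range \<open>Y\<close>; the point \<open>y\<close> outside of \<open>Y\<close> can be chosen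
  between \<open>0\<close> and a multiple of \<open>h\<close>.\<close>

lemma eigenvalue_lower_bound:
  fixes M :: "'a::banach_lattice \<Rightarrow> 'a"
  assumes M: "compact_op M" and pos: "\<And>x. 0 \<le> x \<Longrightarrow> 0 \<le> M x" and h: "quasi_interior h"
    and r: "0 < r" and x: "x \<noteq> 0" "shift_op r M x = 0"
  obtains b where "0 < b" "\<And>n. b * r ^ n \<le> norm ((M ^^ n) h)"
proof -
  define Y where "Y = range (shift_op r M)"
  have linM: "linear M" using M by (rule compact_op_linear)
  have h0: "0 \<le> h" using h by (simp add: quasi_interior_def positive_cone_def)
  have "linear (shift_op r M)"
    using bounded_linear_shift_op[OF compact_op_bounded_linear[OF M]] by (rule bounded_linear.linear)
  then have sub: "subspace Y"
    unfolding Y_def using linear_subspace_image[OF _ subspace_UNIV] by blast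
  have closed: "closed Y"
    unfolding Y_def using compact_shift_closed_range[OF M] r by simp
  then have infdist_pos: "0 < infdist u Y" if "u \<notin> Y" for u
    using that in_closed_iff_infdist_zero[OF closed, of u] infdist_nonneg[of u Y] subspace_0[OF sub]
    by (metis empty_iff order_le_less)
  obtain v where "v \<notin> Y"
    using compact_shift_surj_imp_inj[OF M _ _ x(2)] x(1) r unfolding Y_def by blast
  then obtain u where u: "0 \<le> u" "u \<notin> Y"
    using subspace_diff[OF sub, of "sup v 0" "sup (- v) 0"] by (metis pos_part_diff sup_ge2)
  obtain c where c: "0 \<le> c" "norm (sup (u - c *\<^sub>R h) 0) < infdist u Y"
    using quasi_interior_truncation[OF h infdist_pos[OF u(2)]] by blast
  define y where "y = inf u (c *\<^sub>R h)"
  have y: "0 \<le> y" "y \<le> c *\<^sub>R h"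
    using u(1) c(1) h0 by (auto simp: y_def scaleR_nonneg_nonneg)
  have "u - y = sup (u - c *\<^sub>R h) 0"
    using pos_part_minus[of u "c *\<^sub>R h"] by (simp add: y_def algebra_simps)
  \<comment> \<open>The truncation moves \<open>u\<close> by less than its distance to
    \<open>Y\<close>.\<close>
  then have "y \<notin> Y"
    using c(2) infdist_le[of y Y u] by (auto simp: dist_norm)
  then have d: "0 < infdist y Y" by (rule infdist_pos)
  have mod_Y: "r ^ n *\<^sub>R y - (M ^^ n) y \<in> Y" for n
  proof (induction n)
    case 0
    show ?case using subspace_0[OF sub] by simp
  next
    case (Suc n)
    have "r ^ Suc n *\<^sub>R y - (M ^^ Suc n) y =
        r *\<^sub>R (r ^ n *\<^sub>R y - (M ^^ n) y) + shift_op r M ((M ^^ n) y)"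
      by (simp add: shift_op_def algebra_simps)
    moreover have "shift_op r M ((M ^^ n) y) \<in> Y" by (simp add: Y_def)
    ultimately show ?case
      using Suc sub by (simp only: subspace_add subspace_scale)
  qed
  have lower: "r ^ n * infdist y Y \<le> norm ((M ^^ n) y)" for n
  proof -
    \<comment> \<open>The point of \<open>Y\<close> for which \<open>y - e\<close> is
      \<open>(M ^^ n) y\<close> divided by \<open>r ^ n\<close>.\<close>
    define e where "e = (1 / r ^ n) *\<^sub>R (r ^ n *\<^sub>R y - (M ^^ n) y)"
    have "e \<in> Y" unfolding e_def using sub mod_Y by (intro subspace_scale)
    then have "infdist y Y \<le> norm (y - e)"
      using infdist_le[of e Y y] by (simp add: dist_norm)
    also have "y - e = (1 / r ^ n) *\<^sub>R (M ^^ n) y"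
      using r by (simp add: e_def algebra_simps)
    finally show ?thesis using r by (simp add: field_simps)
  qed
  have pow: "linear (M ^^ n)" for n using linM by (rule linear_funpow)
  have pow_pos: "0 \<le> (M ^^ n) z" if "0 \<le> z" for n z
    by (induction n) (simp_all add: that pos)
  \<comment> \<open>Only \<open>c \<ge> 0\<close> is at hand; \<open>c + 1\<close> can be divided
    by.\<close>
  have upper: "norm ((M ^^ n) y) \<le> (c + 1) * norm ((M ^^ n) h)" for n
  proof -
    have "0 \<le> (M ^^ n) (c *\<^sub>R h - y)" using y(2) by (intro pow_pos) simp
    then have "(M ^^ n) y \<le> c *\<^sub>R (M ^^ n) h"
      by (simp add: linear_diff[OF pow] linear_scale[OF pow])
    then have "norm ((M ^^ n) y) \<le> c * norm ((M ^^ n) h)"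
      using lattice_norm_mono[OF pow_pos[OF y(1)]] c(1) by fastforce
    then show ?thesis by (simp add: distrib_right add_increasing2)
  qed
  show thesis
  proof (rule that)
    show "0 < infdist y Y / (c + 1)" using d c(1) by simp
    show "infdist y Y / (c + 1) * r ^ n \<le> norm ((M ^^ n) h)" for n
      using order_trans[OF lower upper, of n] c(1) by (simp add: field_simps)
  qed
qed

section \<open>Passage to n-th roots\<close>

lemma root_of_geometric_tendsto:
  fixes a r :: real
  assumes "0 < a" "0 < r"
  shows "(\<lambda>n. (a * r ^ n) powr (1 / real n)) \<longlonglongrightarrow> r"
proof -
  have "(\<lambda>n. 1 / real n) \<longlonglongrightarrow> 0"
    using lim_1_over_n by simp
  then have "(\<lambda>n. a powr (1 / real n) * r) \<longlonglongrightarrow> a powr 0 * r"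
    using assms(1) by (intro tendsto_intros) auto
  \<comment> \<open>Index \<open>0\<close> is excluded: there \<open>1 / real n\<close> is
    \<open>0\<close>, so the left side is \<open>r\<close> and the right side
    \<open>1\<close>.\<close>
  moreover have "\<forall>\<^sub>F n in sequentially. a powr (1 / real n) * r = (a * r ^ n) powr (1 / real n)"
    using eventually_gt_at_top[of 0]
  proof eventually_elim
    case (elim n)
    then show ?case
      using assms by (simp add: powr_mult powr_powr flip: powr_realpow)
  qed
  ultimately show ?thesis
    using assms(1) by (simp add: tendsto_cong)
qed

theorem mainTheorem10:
  fixes M :: "'a::banach_lattice \<Rightarrow> 'a" and h :: 'a
  assumes "linear M" and "positive_op M" and "compact_op M"
    and "quasi_interior h"
  shows "(\<lambda>n. norm ((M ^^ n) h) powr (1 / real n)) \<longlonglongrightarrow> spectral_radius M"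
proof -
  let ?r = "growth_radius M"
  have pos: "0 \<le> M x" if "0 \<le> x" for x
    using assms(2) that by (auto simp: positive_op_def positive_cone_def)
  have bl: "bounded_linear M" using assms(3) by (rule compact_op_bounded_linear)
  have "(\<lambda>n. norm ((M ^^ n) h) powr (1 / real n)) \<longlonglongrightarrow> ?r"
  proof (rule order_tendstoI)
    fix a assume "?r < a"
    then obtain \<nu> where \<nu>: "0 < \<nu>" "\<nu> < a" "growth_bounded M \<nu>"
      using growth_bounded_above_radius[OF bl] by blast
    then obtain C where C: "\<And>n x. norm ((M ^^ n) x) \<le> C * \<nu> ^ n * norm x"
      by (auto simp: growth_bounded_def)
    \<comment> \<open>The summand 1 makes the constant positive even if \<open>C\<close> or
      \<open>h\<close> is zero, as the limit of the roots requires.\<close>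
    define D where "D = \<bar>C\<bar> * norm h + 1"
    have D: "0 < D" by (simp add: D_def add_nonneg_pos)
    have "norm ((M ^^ n) h) \<le> D * \<nu> ^ n" for n
    proof -
      have "C * norm h \<le> D"
        using mult_right_mono[OF abs_ge_self[of C] norm_ge_zero[of h]] by (simp add: D_def)
      then have "C * norm h * \<nu> ^ n \<le> D * \<nu> ^ n"
        using \<nu>(1) by (intro mult_right_mono) auto
      then show ?thesis using C[of n h] by (simp add: ac_simps)
    qed
    then have le: "norm ((M ^^ n) h) powr (1 / real n) \<le> (D * \<nu> ^ n) powr (1 / real n)" for n
      by (intro powr_mono2) auto
    have "\<forall>\<^sub>F n in sequentially. (D * \<nu> ^ n) powr (1 / real n) < a"
      using root_of_geometric_tendsto[OF D \<nu>(1)] \<nu>(2) by (rule order_tendstoD)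
    then show "\<forall>\<^sub>F n in sequentially. norm ((M ^^ n) h) powr (1 / real n) < a"
      by (rule eventually_mono) (rule le_less_trans[OF le])
  next
    fix a assume a: "a < ?r"
    show "\<forall>\<^sub>F n in sequentially. a < norm ((M ^^ n) h) powr (1 / real n)"
    proof (cases "?r = 0")
      case True
      \<comment> \<open>At radius zero there is no eigenvector to use, but then \<open>a\<close> is
        negative and the roots are nonnegative.\<close>
      then show ?thesis using a by (intro always_eventually allI) (simp add: less_le_trans)
    next
      case False
      then have r: "0 < ?r" using growth_radius_nonneg[OF bl] by simp
      then obtain b where b: "0 < b" "\<And>n. b * ?r ^ n \<le> norm ((M ^^ n) h)"
        using growth_radius_eigenvector[OF assms(3) pos]
          eigenvalue_lower_bound[OF assms(3) pos assms(4)] by metis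
      have le: "(b * ?r ^ n) powr (1 / real n) \<le> norm ((M ^^ n) h) powr (1 / real n)" for n
        using b r by (intro powr_mono2) auto
      have "\<forall>\<^sub>F n in sequentially. a < (b * ?r ^ n) powr (1 / real n)"
        using root_of_geometric_tendsto[OF b(1) r] a by (rule order_tendstoD)
      then show ?thesis
        by (rule eventually_mono) (rule less_le_trans[OF _ le])
    qed
  qed
  then show ?thesis
    using spectral_radius_eq_growth_radius[OF assms(3) pos] by simp
qed

end
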